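(* Let $W$ be a non-negative, integer-valued random variable with $\mathbb{E}[W]=\lambda>0$, and let $W^\star$ have the $W$-size-biased distribution. If $W^\star\leq_{st}W+1$, then $W_\alpha\leq_{cx}W_\beta$ for all $\alpha,\beta\in[0,1]$ with $\alpha\geq\beta$. In particular, $W\leq_{cx}Z_\lambda$, where $Z_\lambda\sim\mathrm{Po}(\lambda)$.
   Context: $\mathbb{Z}^+=\{0,1,2,\ldots\}$. $\mathrm{Po}(\mu)$ is the Poisson distribution with mean $\mu$. Size biasing: $W^\star$ has mass function $\mathbb{P}(W^\star=j)=j\,\mathbb{P}(W=j)/\lambda$, $j\in\mathbb{Z}^+$. $\leq_{st}$ is the usual stochastic order: $X\leq_{st}Y$ iff $\mathbb{E}f(X)\le\mathbb{E}f(Y)$ for all nondecreasing $f$ for which the expectations exist. $\leq_{cx}$ is the usual convex order: $X\leq_{cx}Y$ iff $\mathbb{E}f(X)\leq\mathbb{E}f(Y)$ for all convex $f$ for which the expectations exist. Definition of $W_\alpha$: for $\alpha\in[0,1]$, $W_\alpha$ is a random variable equal in distribution to $T_\alpha W+Z_{(1-\alpha)\lambda}$, where $T_\alpha W=\sum_{i=1}^W\eta_i$ with $\eta_1,\eta_2,\ldots$ iid Bernoulli random variables of mean $\alpha$, independent of $W$, and $Z_{(1-\alpha)\lambda}\sim\mathrm{Po}((1-\alpha)\lambda)$ independent of all else. (So $W_1$ has the law of $W$ and $W_0\sim\mathrm{Po}(\lambda)$.) *)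

theory Defs
  imports "HOL-Probability.Probability"
begin

text \<open>
  A random variable is given by the probability space it lives on together with a function on
  that space; different random variables may live on different spaces.  In the two stochastic
  orders below, ``the expectations exist'' is read as: both compositions are integrable.
\<close>

definition st_le :: "'a measure \<Rightarrow> ('a \<Rightarrow> real) \<Rightarrow> 'b measure \<Rightarrow> ('b \<Rightarrow> real) \<Rightarrow> bool" where
  "st_le M X N Y \<longleftrightarrow>
     (\<forall>f :: real \<Rightarrow> real. mono f \<longrightarrow>
        integrable M (\<lambda>w. f (X w)) \<longrightarrow> integrable N (\<lambda>w. f (Y w)) \<longrightarrow>
        (\<integral>w. f (X w) \<partial>M) \<le> (\<integral>w. f (Y w) \<partial>N))"

definition cx_le :: "'a measure \<Rightarrow> ('a \<Rightarrow> real) \<Rightarrow> 'b measure \<Rightarrow> ('b \<Rightarrow> real) \<Rightarrow> bool" where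
  "cx_le M X N Y \<longleftrightarrow>
     (\<forall>f :: real \<Rightarrow> real. convex_on UNIV f \<longrightarrow>
        integrable M (\<lambda>w. f (X w)) \<longrightarrow> integrable N (\<lambda>w. f (Y w)) \<longrightarrow>
        (\<integral>w. f (X w) \<partial>M) \<le> (\<integral>w. f (Y w) \<partial>N))"

definition nat_rv :: "'a measure \<Rightarrow> ('a \<Rightarrow> nat) \<Rightarrow> bool" where
  "nat_rv M X \<longleftrightarrow> prob_space M \<and> X \<in> M \<rightarrow>\<^sub>M count_space UNIV"

definition nat_rv_with_law :: "'a measure \<Rightarrow> ('a \<Rightarrow> nat) \<Rightarrow> nat measure \<Rightarrow> bool" where
  "nat_rv_with_law M X L \<longleftrightarrow> nat_rv M X \<and> distr M (count_space UNIV) X = L"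

definition size_biased :: "'b measure \<Rightarrow> ('b \<Rightarrow> nat) \<Rightarrow> 'a measure \<Rightarrow> ('a \<Rightarrow> nat) \<Rightarrow> real \<Rightarrow> bool" where
  "size_biased N V M W lam \<longleftrightarrow> nat_rv N V \<and>
     (\<forall>j. measure N {w \<in> space N. V w = j} = real j * measure M {w \<in> space M. W w = j} / lam)"

text \<open>
  The library's \<^const>\<open>poisson_pmf\<close> is only specified for a positive rate, but the mean
  \<open>(1 - \<alpha>) * lam\<close> vanishes for \<open>\<alpha> = 1\<close>; the Poisson law of mean 0 is the point mass at 0.
\<close>

definition Po :: "real \<Rightarrow> nat pmf" where
  "Po \<mu> = (if \<mu> = 0 then return_pmf 0 else poisson_pmf \<mu>)"

text \<open>
  The law of \<open>T\<^sub>\<alpha> W + Z\<close>, realised on a product space: \<open>W\<close> lives on the first factor, the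
  second factor carries the iid Bernoulli sequence, and the third one the Poisson variable \<open>Z\<close>,
  so that all of these are independent.
\<close>

definition W_alpha_space :: "'a measure \<Rightarrow> real \<Rightarrow> real \<Rightarrow> ('a \<times> (nat \<Rightarrow> bool) \<times> nat) measure" where
  "W_alpha_space M lam \<alpha> =
     M \<Otimes>\<^sub>M (\<Pi>\<^sub>M i\<in>UNIV. measure_pmf (bernoulli_pmf \<alpha>)) \<Otimes>\<^sub>M measure_pmf (Po ((1 - \<alpha>) * lam))"

definition W_alpha_law :: "'a measure \<Rightarrow> ('a \<Rightarrow> nat) \<Rightarrow> real \<Rightarrow> real \<Rightarrow> nat measure" where
  "W_alpha_law M W lam \<alpha> =
     distr (W_alpha_space M lam \<alpha>) (count_space UNIV)
       (\<lambda>(w, \<eta>, z). (\<Sum>i<W w. of_bool (\<eta> i)) + z)"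

lemma W_alpha_measurable:
  assumes "W \<in> M \<rightarrow>\<^sub>M count_space UNIV"
  shows "(\<lambda>(w, \<eta>, z). (\<Sum>i<W w. of_bool (\<eta> i)) + z)
           \<in> W_alpha_space M lam \<alpha> \<rightarrow>\<^sub>M (count_space UNIV :: nat measure)"
proof -
  have c [measurable]: "(\<lambda>p. fst (snd p) i) \<in> W_alpha_space M lam \<alpha> \<rightarrow>\<^sub>M count_space UNIV" for i
  proof -
    have "(\<lambda>p. fst (snd p) i) \<in> W_alpha_space M lam \<alpha> \<rightarrow>\<^sub>M measure_pmf (bernoulli_pmf \<alpha>)"
      unfolding W_alpha_space_def by measurable
    then show ?thesis by (simp cong: measurable_cong_sets)
  qed
  have z [measurable]: "(\<lambda>p. snd (snd p)) \<in> W_alpha_space M lam \<alpha> \<rightarrow>\<^sub>M count_space UNIV"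
  proof -
    have "(\<lambda>p. snd (snd p)) \<in> W_alpha_space M lam \<alpha> \<rightarrow>\<^sub>M measure_pmf (Po ((1 - \<alpha>) * lam))"
      unfolding W_alpha_space_def by measurable
    then show ?thesis by (simp cong: measurable_cong_sets)
  qed
  have w [measurable]: "(\<lambda>p. W (fst p)) \<in> W_alpha_space M lam \<alpha> \<rightarrow>\<^sub>M count_space UNIV"
    unfolding W_alpha_space_def using assms by measurable
  have s: "(\<lambda>p. \<Sum>i<n. of_bool (fst (snd p) i)) \<in> W_alpha_space M lam \<alpha> \<rightarrow>\<^sub>M (count_space UNIV :: nat measure)" for n
    by (induction n) (simp_all, measurable)
  have [measurable]: "(\<lambda>p. \<Sum>i<W (fst p). of_bool (fst (snd p) i)) \<in> W_alpha_space M lam \<alpha> \<rightarrow>\<^sub>M (count_space UNIV :: nat measure)"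
    by (rule measurable_compose_countable[OF s w])
  have "(\<lambda>p. (\<Sum>i<W (fst p). of_bool (fst (snd p) i)) + snd (snd p))
           \<in> W_alpha_space M lam \<alpha> \<rightarrow>\<^sub>M (count_space UNIV :: nat measure)"
    by measurable
  then show ?thesis by (simp add: case_prod_unfold)
qed

end

theory Submission
  imports Defs
begin

text \<open>
  Put \<open>\<alpha> = exp (- t)\<close>.  Then \<open>W\<^sub>\<alpha>\<close> is the state at time \<open>t\<close> of an M/M/\<open>\<infinity>\<close> queue that starts
  with \<open>W\<close> customers, has arrival rate \<open>\<lambda>\<close> and has unit service rate; its stationary law is
  Poisson with mean \<open>\<lambda>\<close>.  Write \<open>g\<^sub>\<alpha> h j = E h (Bin (j, \<alpha>) + Po ((1 - \<alpha>) * \<lambda>))\<close> for its transition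
  expectation and \<open>\<Delta>h n = h (n + 1) - h n\<close>.  The backward equation, in terms of \<open>\<alpha>\<close>, is

  \<open>d/d\<alpha> g\<^sub>\<alpha> h j = j * g\<^sub>\<alpha> (\<Delta>h) (j - 1) - \<lambda> * g\<^sub>\<alpha> (\<Delta>h) j\<close>.

  Averaging over the law of \<open>W\<close>, the definition of size biasing turns the right-hand side into
  \<open>\<lambda> * (E g\<^sub>\<alpha> (\<Delta>h) (W\<^sup>* - 1) - E g\<^sub>\<alpha> (\<Delta>h) W)\<close>.  If \<open>h\<close> is convex, then \<open>\<Delta>h\<close> and hence
  \<open>g\<^sub>\<alpha> (\<Delta>h)\<close> are nondecreasing, so this is at most 0 because \<open>W\<^sup>*\<close> is stochastically below
  \<open>W + 1\<close>.  Thus \<open>E h (W\<^sub>\<alpha>)\<close> decreases in \<open>\<alpha>\<close>.  Letting the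
  semigroup act on \<open>h\<close> rather than on the law keeps the order hypothesis in terms of \<open>W\<close> for all \<open>\<alpha>\<close>.

  The analysis is kept elementary by the choice of \<open>h\<close>.  Since every \<open>W\<^sub>\<alpha>\<close> has mean \<open>\<lambda>\<close>, the convex
  order follows from the functions \<open>h n = max (k - n) 0\<close> (\<open>cx_le_of_put_le\<close>).  These
  are bounded and vanish from \<open>k\<close> on, so the Poisson expectation in \<open>g\<^sub>\<alpha> h\<close> is a finite sum, and
  \<open>- \<Delta>h\<close> is the indicator of \<open>n < k\<close>, so the derivative is bounded by \<open>\<lambda> + j\<close>, which is
  integrable for the law of \<open>W\<close>; this permits differentiation under the expectation
  (\<open>put_expectation_antimono\<close>).  The comparison of \<open>W\<close> with \<open>Po \<lambda>\<close> is that
  of the parameters 1 and 0.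
\<close>

section \<open>The thinned variable and its derivative in the thinning parameter\<close>

text \<open>
  Cutting the Poisson series at \<open>K\<close> loses nothing for functions that vanish from \<open>K\<close> on, and it
  gives an expression that is differentiable at every real rate, including the rate 0 that
  \<open>\<alpha> = 1\<close> produces.
\<close>

definition poisson_sum :: "nat \<Rightarrow> real \<Rightarrow> (nat \<Rightarrow> real) \<Rightarrow> real" where
  "poisson_sum K \<mu> h = (\<Sum>n<K. \<mu> ^ n / fact n * exp (- \<mu>) * h n)"

text \<open>
  For \<open>h\<close> vanishing from \<open>K\<close> on this is \<open>E h (Bin (j, \<alpha>) + Po ((1 - \<alpha>) * lam))\<close>.  The recursion
  conditions on one of the \<open>j\<close> Bernoulli variables; it replaces binomial sums in all the inductions
  below.
\<close>

primrec thin_expect :: "nat \<Rightarrow> real \<Rightarrow> real \<Rightarrow> nat \<Rightarrow> (nat \<Rightarrow> real) \<Rightarrow> real" where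
  "thin_expect K lam \<alpha> 0 h = poisson_sum K ((1 - \<alpha>) * lam) h"
| "thin_expect K lam \<alpha> (Suc j) h =
     \<alpha> * thin_expect K lam \<alpha> j (\<lambda>n. h (Suc n)) + (1 - \<alpha>) * thin_expect K lam \<alpha> j h"

lemma poisson_sum_mono:
  assumes "0 \<le> \<mu>" "\<And>n. h n \<le> h' n"
  shows "poisson_sum K \<mu> h \<le> poisson_sum K \<mu> h'"
  unfolding poisson_sum_def using assms by (intro sum_mono mult_left_mono) auto

lemma poisson_sum_one_le:
  assumes "0 \<le> \<mu>"
  shows "poisson_sum K \<mu> (\<lambda>_. 1) \<le> 1"
proof -
  have s: "(\<lambda>n. \<mu> ^ n / fact n) sums exp \<mu>"
    using exp_converges[of \<mu>] by (simp add: field_simps)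
  have "(\<Sum>n<K. \<mu> ^ n / fact n) \<le> exp \<mu>"
    using sum_le_suminf[of "\<lambda>n. \<mu> ^ n / fact n" "{..<K}"] s assms by (auto simp: sums_iff)
  then have "(\<Sum>n<K. \<mu> ^ n / fact n) * exp (- \<mu>) \<le> exp \<mu> * exp (- \<mu>)"
    by (intro mult_right_mono) auto
  then show ?thesis
    by (simp add: poisson_sum_def sum_distrib_right flip: exp_add)
qed

lemma poisson_sum_diff:
  "poisson_sum K \<mu> (\<lambda>n. h n - h' n) = poisson_sum K \<mu> h - poisson_sum K \<mu> h'"
  by (simp add: poisson_sum_def right_diff_distrib sum_subtractf)

lemma DERIV_poisson_weight:
  "((\<lambda>\<mu>. \<mu> ^ n / fact n * exp (- \<mu>)) has_real_derivative
     ((if n = 0 then 0 else \<mu> ^ (n - 1) / fact (n - 1) * exp (- \<mu>)) - \<mu> ^ n / fact n * exp (- \<mu>))) (at \<mu>)"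
proof (cases n)
  case 0
  then show ?thesis by (auto intro!: derivative_eq_intros)
next
  case (Suc m)
  have "real (Suc m) * \<mu> ^ m / fact (Suc m) = \<mu> ^ m / fact m"
    by (simp del: of_nat_Suc)
  then have "real (Suc m) * \<mu> ^ m / fact (Suc m) * exp (- \<mu>) + - exp (- \<mu>) * (\<mu> ^ Suc m / fact (Suc m))
      = \<mu> ^ m / fact m * exp (- \<mu>) - \<mu> ^ Suc m / fact (Suc m) * exp (- \<mu>)"
    by simp
  moreover have "((\<lambda>\<mu>. \<mu> ^ Suc m / fact (Suc m) * exp (- \<mu>)) has_real_derivative
      real (Suc m) * \<mu> ^ m / fact (Suc m) * exp (- \<mu>) + - exp (- \<mu>) * (\<mu> ^ Suc m / fact (Suc m))) (at \<mu>)"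
    by (intro DERIV_mult DERIV_cdivide) (auto intro!: derivative_eq_intros simp del: power_Suc)
  ultimately show ?thesis unfolding Suc by (simp add: mult.commute)
qed

text \<open>
  Summation by parts of the Poisson weights; the subtracted term is the boundary contribution of
  the cut at \<open>K\<close>.
\<close>

lemma DERIV_poisson_sum_boundary:
  "((\<lambda>\<mu>. poisson_sum K \<mu> h) has_real_derivative
     poisson_sum K \<mu> (\<lambda>n. h (Suc n) - h n)
       - (if K = 0 then 0 else \<mu> ^ (K - 1) / fact (K - 1) * exp (- \<mu>)) * h K) (at \<mu>)"
proof (induction K)
  case 0
  then show ?case by (simp add: poisson_sum_def)
next
  case (Suc K)
  let ?v = "if K = 0 then 0 else \<mu> ^ (K - 1) / fact (K - 1) * exp (- \<mu>)"
  let ?w = "\<mu> ^ K / fact K * exp (- \<mu>)"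
  let ?q = "poisson_sum K \<mu> (\<lambda>n. h (Suc n) - h n)"
  have "((\<lambda>\<mu>. poisson_sum K \<mu> h + \<mu> ^ K / fact K * exp (- \<mu>) * h K) has_real_derivative
     ?q - ?v * h K + (?v - ?w) * h K) (at \<mu>)"
    by (intro DERIV_add Suc DERIV_cmult_right DERIV_poisson_weight)
  moreover have "?q - ?v * h K + (?v - ?w) * h K = (?q + ?w * (h (Suc K) - h K)) - ?w * h (Suc K)"
    by (simp only: ring_distribs)
  ultimately show ?case
    unfolding poisson_sum_def sum.lessThan_Suc by (simp only:) simp
qed

lemma DERIV_poisson_sum:
  assumes "h K = 0"
  shows "((\<lambda>\<mu>. poisson_sum K \<mu> h) has_real_derivative
     poisson_sum K \<mu> (\<lambda>n. h (Suc n) - h n)) (at \<mu>)"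
  using DERIV_poisson_sum_boundary[of K h \<mu>] assms by simp

lemma thin_expect_mono:
  assumes "\<alpha> \<in> {0..1}" "0 \<le> lam" "\<And>n. h n \<le> h' n"
  shows "thin_expect K lam \<alpha> j h \<le> thin_expect K lam \<alpha> j h'"
  using assms(3)
proof (induction j arbitrary: h h')
  case 0
  with assms show ?case by (auto intro!: poisson_sum_mono)
next
  case (Suc j)
  with assms show ?case by (auto intro!: add_mono mult_left_mono)
qed

lemma thin_expect_one_le:
  assumes "\<alpha> \<in> {0..1}" "0 \<le> lam"
  shows "thin_expect K lam \<alpha> j (\<lambda>_. 1) \<le> 1"
proof (induction j)
  case 0
  with assms show ?case by (auto intro!: poisson_sum_one_le)
next
  case (Suc j)
  then show ?case by (simp add: algebra_simps)
qed

lemma thin_expect_zero: "thin_expect K lam \<alpha> j (\<lambda>_. 0) = 0"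
  by (induction j) (auto simp: poisson_sum_def)

lemma thin_expect_nonneg:
  assumes "\<alpha> \<in> {0..1}" "0 \<le> lam" "\<And>n. 0 \<le> h n"
  shows "0 \<le> thin_expect K lam \<alpha> j h"
  using thin_expect_mono[OF assms, of K j] by (simp add: thin_expect_zero)

lemma thin_expect_diff:
  "thin_expect K lam \<alpha> j (\<lambda>n. h n - h' n) = thin_expect K lam \<alpha> j h - thin_expect K lam \<alpha> j h'"
proof (induction j arbitrary: h h')
  case 0
  then show ?case by (simp add: poisson_sum_diff)
next
  case (Suc j)
  show ?case unfolding thin_expect.simps Suc.IH by (simp add: algebra_simps)
qed

text \<open>
  One more Bernoulli variable can only enlarge the sum: conditioning on it compares \<open>h\<close> with its
  shift.
\<close>

lemma thin_expect_antimono: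
  assumes "\<alpha> \<in> {0..1}" "0 \<le> lam" "antimono h"
  shows "antimono (\<lambda>j. thin_expect K lam \<alpha> j h)"
proof (rule decseq_SucI)
  fix j
  have "thin_expect K lam \<alpha> j (\<lambda>n. h (Suc n)) \<le> thin_expect K lam \<alpha> j h"
    using assms by (intro thin_expect_mono) (auto simp: decseq_SucD)
  then have "\<alpha> * thin_expect K lam \<alpha> j (\<lambda>n. h (Suc n)) \<le> \<alpha> * thin_expect K lam \<alpha> j h"
    using assms by (intro mult_left_mono) auto
  then show "thin_expect K lam \<alpha> (Suc j) h \<le> thin_expect K lam \<alpha> j h"
    by (simp add: algebra_simps)
qed

text \<open>
  The backward equation of the queue in the variable \<open>\<alpha>\<close>.  In the induction over \<open>j\<close>, the Poisson
  rate contributes the term with \<open>lam\<close>, and each of the \<open>j\<close> Bernoulli variables contributes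
  the effect of switching it from failure to success, given the other \<open>j - 1\<close>.
\<close>

lemma DERIV_thin_expect:
  assumes "\<And>n. K \<le> n \<Longrightarrow> h n = 0"
  shows "((\<lambda>\<alpha>. thin_expect K lam \<alpha> j h) has_real_derivative
     (real j * thin_expect K lam \<alpha> (j - 1) (\<lambda>n. h (Suc n) - h n)
       - lam * thin_expect K lam \<alpha> j (\<lambda>n. h (Suc n) - h n))) (at \<alpha>)"
  using assms
proof (induction j arbitrary: h)
  case 0
  have "((\<lambda>\<alpha>. poisson_sum K ((1 - \<alpha>) * lam) h) has_real_derivative
      poisson_sum K ((1 - \<alpha>) * lam) (\<lambda>n. h (Suc n) - h n) * (- lam)) (at \<alpha>)"
    by (rule DERIV_chain2[OF DERIV_poisson_sum]) (auto intro!: derivative_eq_intros simp: 0)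
  then show ?case by (simp add: algebra_simps)
next
  case (Suc j)
  let ?g = "\<lambda>h j. thin_expect K lam \<alpha> j h"
  let ?D = "\<lambda>h n. h (Suc n) - h n"
  let ?s = "\<lambda>n. h (Suc n)"
  have 1: "((\<lambda>\<alpha>. thin_expect K lam \<alpha> j ?s) has_real_derivative
     (real j * ?g (?D ?s) (j - 1) - lam * ?g (?D ?s) j)) (at \<alpha>)"
    using Suc.prems by (intro Suc.IH) auto
  have 2: "((\<lambda>\<alpha>. thin_expect K lam \<alpha> j h) has_real_derivative
     (real j * ?g (?D h) (j - 1) - lam * ?g (?D h) j)) (at \<alpha>)"
    using Suc.prems by (intro Suc.IH) auto
  have d: "?g ?s j - ?g h j = ?g (?D h) j"
    by (simp add: thin_expect_diff)
  have r: "real j * ?g (?D h) j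
      = \<alpha> * (real j * ?g (?D ?s) (j - 1)) + (1 - \<alpha>) * (real j * ?g (?D h) (j - 1))"
    by (cases j) (simp_all add: algebra_simps)
  have r': "?g (?D h) (Suc j) = \<alpha> * ?g (?D ?s) j + (1 - \<alpha>) * ?g (?D h) j"
    by simp
  have "((\<lambda>\<alpha>. \<alpha> * thin_expect K lam \<alpha> j ?s + (1 - \<alpha>) * thin_expect K lam \<alpha> j h) has_real_derivative
     ((1 * ?g ?s j + (real j * ?g (?D ?s) (j - 1) - lam * ?g (?D ?s) j) * \<alpha>)
      + ((0 - 1) * ?g h j + (real j * ?g (?D h) (j - 1) - lam * ?g (?D h) j) * (1 - \<alpha>)))) (at \<alpha>)"
    by (intro DERIV_add DERIV_mult DERIV_diff DERIV_ident DERIV_const 1 2)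
  moreover have "(1 * ?g ?s j + (real j * ?g (?D ?s) (j - 1) - lam * ?g (?D ?s) j) * \<alpha>)
      + ((0 - 1) * ?g h j + (real j * ?g (?D h) (j - 1) - lam * ?g (?D h) j) * (1 - \<alpha>))
      = real (Suc j) * ?g (?D h) j - lam * ?g (?D h) (Suc j)"
    using d r unfolding r' by (simp add: algebra_simps del: thin_expect.simps)
  ultimately show ?case by simp
qed

section \<open>Expectations of natural-number-valued variables\<close>

lemma nat_rv_sums:
  fixes \<phi> :: "nat \<Rightarrow> real"
  assumes "nat_rv M X" "integrable M (\<lambda>w. \<phi> (X w))"
  shows "(\<lambda>j. measure M {w \<in> space M. X w = j} * \<phi> j) sums (\<integral>w. \<phi> (X w) \<partial>M)"
proof -
  interpret prob_space M using assms by (simp add: nat_rv_def)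
  have X [measurable]: "X \<in> M \<rightarrow>\<^sub>M count_space UNIV" using assms by (simp add: nat_rv_def)
  let ?D = "distr M (count_space UNIV) X"
  let ?p = "\<lambda>j. measure M {w \<in> space M. X w = j}"
  have D: "?D = density (count_space UNIV) (\<lambda>j. ennreal (?p j))"
  proof (rule measure_eqI_countable[of _ UNIV])
    fix a :: nat
    have "emeasure ?D {a} = emeasure M {w \<in> space M. X w = a}"
      by (subst emeasure_distr) (auto intro!: arg_cong2[where f=emeasure])
    then show "emeasure ?D {a} = emeasure (density (count_space UNIV) (\<lambda>j. ennreal (?p j))) {a}"
      by (subst emeasure_density) (auto simp: emeasure_eq_measure)
  qed auto
  have "integrable ?D \<phi>" using assms(2) by (subst integrable_distr_eq) auto
  then have "integrable (count_space UNIV) (\<lambda>j. ?p j * \<phi> j)"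
    unfolding D by (subst (asm) integrable_density) auto
  then have "(\<lambda>j. ?p j * \<phi> j) sums (\<integral>j. ?p j * \<phi> j \<partial>count_space UNIV)"
    by (rule sums_integral_count_space_nat)
  also have "(\<integral>j. ?p j * \<phi> j \<partial>count_space UNIV) = (\<integral>j. \<phi> j \<partial>?D)"
    unfolding D by (subst integral_density) auto
  also have "\<dots> = (\<integral>w. \<phi> (X w) \<partial>M)"
    by (subst integral_distr) auto
  finally show ?thesis .
qed

lemma nat_rv_integrable_bounded:
  fixes \<phi> :: "nat \<Rightarrow> real"
  assumes "nat_rv M X" "\<And>n. \<bar>\<phi> n\<bar> \<le> B"
  shows "integrable M (\<lambda>w. \<phi> (X w))"
proof -
  interpret prob_space M using assms by (simp add: nat_rv_def)
  have X [measurable]: "X \<in> M \<rightarrow>\<^sub>M count_space UNIV" using assms by (simp add: nat_rv_def)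
  show ?thesis using assms by (intro integrable_const_bound[where B=B]) auto
qed

section \<open>Convex order from mean and truncated differences\<close>

text \<open>
  Discrete Taylor expansion: a sequence is an affine function plus a combination of
  the call functions \<open>n \<mapsto> max (n - k) 0\<close>, \<open>k \<ge> 1\<close>, whose coefficients are the second differences.
  Natural-number subtraction is the truncated difference.
\<close>

lemma convex_sequence_decomposition:
  fixes a :: "nat \<Rightarrow> real"
  shows "a n = a 0 + (a 1 - a 0) * real n
    + (\<Sum>k. (a (k + 2) - 2 * a (k + 1) + a k) * real (n - (k + 1)))"
proof -
  let ?c = "\<lambda>k. a (k + 2) - 2 * a (k + 1) + a k"
  have s: "(\<Sum>k. ?c k * real (n - (k + 1))) = (\<Sum>k<n. ?c k * real (n - (k + 1)))"
    by (rule suminf_finite) auto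
  have d: "(\<Sum>k<n. ?c k) = (a (n + 1) - a n) - (a 1 - a 0)" for n
    by (induction n) (auto simp: algebra_simps)
  have "a n = a 0 + (a 1 - a 0) * real n + (\<Sum>k<n. ?c k * real (n - (k + 1)))"
  proof (induction n)
    case (Suc n)
    have "(\<Sum>k<Suc n. ?c k * real (Suc n - (k + 1))) = (\<Sum>k<n. ?c k * real (n - k))
        + ?c n * real (n - n)"
      by (simp only: sum.lessThan_Suc) simp
    also have "(\<Sum>k<n. ?c k * real (n - k)) = (\<Sum>k<n. ?c k * real (n - (k + 1)) + ?c k)"
    proof (rule sum.cong)
      fix k assume "k \<in> {..<n}"
      then have "real (n - k) = real (n - (k + 1)) + 1" by auto
      then show "?c k * real (n - k) = ?c k * real (n - (k + 1)) + ?c k"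
        by (simp only: ring_distribs mult_1_right)
    qed simp
    also have "\<dots> = (\<Sum>k<n. ?c k * real (n - (k + 1))) + ((a (n + 1) - a n) - (a 1 - a 0))"
      by (simp only: sum.distrib flip: d)
    finally show ?case using Suc by (simp add: algebra_simps)
  qed auto
  then show ?thesis by (simp only: s)
qed

lemma convex_second_difference_nonneg:
  fixes f :: "real \<Rightarrow> real"
  assumes "convex_on UNIV f"
  shows "0 \<le> f (real (k + 2)) - 2 * f (real (k + 1)) + f (real k)"
proof -
  have "(1 - 1/2) *\<^sub>R real k + (1/2) *\<^sub>R real (k + 2) = real (k + 1)" by (simp add: field_simps)
  then show ?thesis
    using convex_onD[OF assms, of "1/2" "real k" "real (k + 2)"] by simp
qed

text \<open>
  On the integers a convex function is an affine function plus a nonnegative combination of call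
  functions, and monotone convergence exchanges the expectation with this infinite combination.
  The affine part is settled by the means.  Call functions are reduced to the put
  functions \<open>n \<mapsto> max (k - n) 0\<close> by \<open>max (n - k) 0 = max (k - n) 0 + (n - k)\<close>, again with equal means.
\<close>

lemma cx_le_of_put_le:
  assumes A: "nat_rv A X" and B: "nat_rv B Y"
    and iX: "integrable A (\<lambda>w. real (X w))" and iY: "integrable B (\<lambda>w. real (Y w))"
    and mean: "(\<integral>w. real (X w) \<partial>A) = (\<integral>w. real (Y w) \<partial>B)"
    and put: "\<And>k. (\<integral>w. real (k - X w) \<partial>A) \<le> (\<integral>w. real (k - Y w) \<partial>B)"
  shows "cx_le A (\<lambda>w. real (X w)) B (\<lambda>w. real (Y w))"
  unfolding cx_le_def
proof (intro allI impI)
  fix f :: "real \<Rightarrow> real"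
  assume f: "convex_on UNIV f" and fX: "integrable A (\<lambda>w. f (real (X w)))"
    and fY: "integrable B (\<lambda>w. f (real (Y w)))"
  interpret A: prob_space A using A by (simp add: nat_rv_def)
  interpret B: prob_space B using B by (simp add: nat_rv_def)
  have [measurable]: "X \<in> A \<rightarrow>\<^sub>M count_space UNIV" "Y \<in> B \<rightarrow>\<^sub>M count_space UNIV"
    using A B by (simp_all add: nat_rv_def)
  define c where "c k = f (real (k + 2)) - 2 * f (real (k + 1)) + f (real k)" for k :: nat
  define d where "d = f 1 - f 0"
  define R where "R n = (\<Sum>k. c k * real (n - (k + 1)))" for n
  have c0: "c k \<ge> 0" for k unfolding c_def by (rule convex_second_difference_nonneg[OF f])
  have fR: "f (real n) = f 0 + d * real n + R n" for n
    using convex_sequence_decomposition[of "\<lambda>n. f (real n)" n]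
    unfolding d_def R_def c_def by simp
  have Rsum: "summable (\<lambda>k. c k * real (n - (k + 1)))" for n
    by (rule summable_finite[of "{..<n}"]) auto
  have R0: "R n \<ge> 0" for n
    unfolding R_def by (rule suminf_nonneg[OF Rsum]) (simp add: c0)
  have eR: "ennreal (R n) = (\<Sum>k. ennreal (c k) * ennreal (real (n - (k + 1))))" for n
  proof -
    have "ennreal (R n) = (\<Sum>k. ennreal (c k * real (n - (k + 1))))"
      unfolding R_def by (rule suminf_ennreal2[symmetric]) (simp_all only: Rsum c0 of_nat_0_le_iff mult_nonneg_nonneg)
    then show ?thesis by (simp only: ennreal_mult[OF c0 of_nat_0_le_iff])
  qed
  have call: "(\<integral>\<^sup>+w. ennreal (real (X w - k)) \<partial>A) \<le> (\<integral>\<^sup>+w. ennreal (real (Y w - k)) \<partial>B)" for k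
  proof -
    have e: "real (n - k) = real (k - n) + (real n - real k)" for n by simp
    have iX': "integrable A (\<lambda>w. real (k - X w))"
      by (rule nat_rv_integrable_bounded[OF A, of "\<lambda>n. real (k - n)" "real k"]) auto
    have iY': "integrable B (\<lambda>w. real (k - Y w))"
      by (rule nat_rv_integrable_bounded[OF B, of "\<lambda>n. real (k - n)" "real k"]) auto
    have iX'': "integrable A (\<lambda>w. real (X w - k))"
      unfolding e[of "X _"] using iX iX' by (intro Bochner_Integration.integrable_add Bochner_Integration.integrable_diff) auto
    have iY'': "integrable B (\<lambda>w. real (Y w - k))"
      unfolding e[of "Y _"] using iY iY' by (intro Bochner_Integration.integrable_add Bochner_Integration.integrable_diff) auto
    have "(\<integral>w. real (X w - k) \<partial>A) \<le> (\<integral>w. real (Y w - k) \<partial>B)"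
      unfolding e[of "X _"] e[of "Y _"] using iX iX' iY iY' put[of k] mean
      by (simp add: A.prob_space B.prob_space del: of_nat_diff_if)
    then show ?thesis
      using iX'' iY'' by (simp add: nn_integral_eq_integral ennreal_leI)
  qed
  have RX: "integrable A (\<lambda>w. R (X w))"
  proof -
    have "integrable A (\<lambda>w. f (real (X w)) - (f 0 + d * real (X w)))" using fX iX by auto
    then show ?thesis by (simp add: fR)
  qed
  have RY: "integrable B (\<lambda>w. R (Y w))"
  proof -
    have "integrable B (\<lambda>w. f (real (Y w)) - (f 0 + d * real (Y w)))" using fY iY by auto
    then show ?thesis by (simp add: fR)
  qed
  have "(\<integral>\<^sup>+w. ennreal (R (X w)) \<partial>A)
      = (\<Sum>k. ennreal (c k) * (\<integral>\<^sup>+w. ennreal (real (X w - (k + 1))) \<partial>A))"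
    unfolding eR by (subst nn_integral_suminf) (auto simp: nn_integral_cmult)
  also have "\<dots> \<le> (\<Sum>k. ennreal (c k) * (\<integral>\<^sup>+w. ennreal (real (Y w - (k + 1))) \<partial>B))"
    by (intro suminf_le mult_left_mono call) auto
  also have "\<dots> = (\<integral>\<^sup>+w. ennreal (R (Y w)) \<partial>B)"
    unfolding eR by (subst nn_integral_suminf) (auto simp: nn_integral_cmult)
  finally have "(\<integral>w. R (X w) \<partial>A) \<le> (\<integral>w. R (Y w) \<partial>B)"
    by (simp add: nn_integral_eq_integral RX RY R0 integral_nonneg_AE)
  then show "(\<integral>w. f (real (X w)) \<partial>A) \<le> (\<integral>w. f (real (Y w)) \<partial>B)"
    unfolding fR using iX iY RX RY mean by (simp add: A.prob_space B.prob_space)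
qed

section \<open>The law of the thinned variable\<close>

lemma pmf_Po: "0 \<le> \<mu> \<Longrightarrow> pmf (Po \<mu>) n = \<mu> ^ n / fact n * exp (- \<mu>)"
  by (cases n) (auto simp: Po_def pmf_return)

lemma nn_integral_Po_truncated:
  assumes "0 \<le> \<mu>" "\<And>n. 0 \<le> h n" "\<And>n. K \<le> n \<Longrightarrow> h n = 0"
  shows "(\<integral>\<^sup>+n. ennreal (h n) \<partial>measure_pmf (Po \<mu>)) = ennreal (poisson_sum K \<mu> h)"
proof -
  have "(\<integral>\<^sup>+n. ennreal (h n) \<partial>measure_pmf (Po \<mu>))
      = (\<Sum>n<K. ennreal (h n) * ennreal (pmf (Po \<mu>) n))"
    using assms by (intro nn_integral_measure_pmf_support) (auto simp: not_less)
  also have "\<dots> = (\<Sum>n<K. ennreal (\<mu> ^ n / fact n * exp (- \<mu>) * h n))"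
    using assms by (intro sum.cong) (simp_all add: pmf_Po mult.commute flip: ennreal_mult)
  also have "\<dots> = ennreal (poisson_sum K \<mu> h)"
    unfolding poisson_sum_def using assms by (intro sum_ennreal) auto
  finally show ?thesis .
qed

lemma nn_integral_Po_shift:
  assumes "0 \<le> \<mu>"
  shows "(\<integral>\<^sup>+n. ennreal (real (n + c)) \<partial>measure_pmf (Po \<mu>)) = ennreal (\<mu> + real c)"
proof -
  let ?w = "\<lambda>n. \<mu> ^ n / fact n * exp (- \<mu>)"
  have "(\<lambda>n. \<mu> ^ n / fact n) sums exp \<mu>"
    using exp_converges[of \<mu>] by (simp add: field_simps)
  then have "(\<lambda>n. ?w n) sums (exp \<mu> * exp (- \<mu>))"
    by (rule sums_mult2)
  then have w: "?w sums 1" by (simp flip: exp_add)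
  have e: "\<mu> * ?w n = real (Suc n) * ?w (Suc n)" for n
    by (simp add: divide_simps)
  have "(\<lambda>n. real (Suc n) * ?w (Suc n)) sums (\<mu> * 1)"
    using sums_mult[OF w, of \<mu>] unfolding e .
  then have "(\<lambda>n. real n * ?w n) sums \<mu>"
    by (subst (asm) sums_Suc_iff) simp
  then have "(\<lambda>n. real n * ?w n + real c * ?w n) sums (\<mu> + real c * 1)"
    by (intro sums_add sums_mult w)
  then have s: "(\<lambda>n. ?w n * real (n + c)) sums (\<mu> + real c)"
    by (simp only: of_nat_add ring_distribs mult.commute mult_1_right mult_1_left)
  have "(\<integral>\<^sup>+n. ennreal (real (n + c)) \<partial>measure_pmf (Po \<mu>))
      = (\<Sum>n. ennreal (?w n * real (n + c)))"
    unfolding nn_integral_measure_pmf nn_integral_count_space_nat pmf_Po[OF assms]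
    using assms by (intro suminf_cong ennreal_mult[symmetric]) auto
  also have "\<dots> = ennreal (\<mu> + real c)"
    using s assms by (subst suminf_ennreal2) (auto simp: sums_iff)
  finally show ?thesis .
qed

text \<open>
  Prepending an independent Bernoulli variable to an iid Bernoulli sequence reproduces the
  law of the sequence (\<open>PiM_iter\<close>).  So the first variable can be split off and
  integrated separately, which is the recursion of \<open>thin_expect\<close>.
\<close>

lemma nn_integral_bernoulli_sum_Suc:
  fixes H :: "nat \<Rightarrow> ennreal"
  assumes "\<alpha> \<in> {0..1}"
  defines "S \<equiv> \<Pi>\<^sub>M i\<in>(UNIV :: nat set). measure_pmf (bernoulli_pmf \<alpha>)"
  shows "(\<integral>\<^sup>+\<eta>. H (\<Sum>i<Suc j. of_bool (\<eta> i)) \<partial>S)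
     = ennreal \<alpha> * (\<integral>\<^sup>+\<eta>. H (Suc (\<Sum>i<j. of_bool (\<eta> i))) \<partial>S)
       + ennreal (1 - \<alpha>) * (\<integral>\<^sup>+\<eta>. H (\<Sum>i<j. of_bool (\<eta> i)) \<partial>S)"
proof -
  let ?b = "measure_pmf (bernoulli_pmf \<alpha>)"
  interpret sequence_space ?b by unfold_locales
  have c [measurable]: "(\<lambda>\<eta>. \<eta> i) \<in> S \<rightarrow>\<^sub>M count_space UNIV" for i
  proof -
    have "(\<lambda>\<eta>. \<eta> i) \<in> S \<rightarrow>\<^sub>M ?b" unfolding S_def by measurable
    then show ?thesis by (simp cong: measurable_cong_sets)
  qed
  have s: "(\<lambda>\<eta>. \<Sum>i<n. of_bool (\<eta> i)) \<in> S \<rightarrow>\<^sub>M (count_space UNIV :: nat measure)" for n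
    by (induction n) (simp_all, measurable)
  have m: "(\<lambda>(x, \<eta>). case_nat x \<eta>) \<in> ?b \<Otimes>\<^sub>M S \<rightarrow>\<^sub>M S"
    unfolding S_def by measurable
  have it: "distr (?b \<Otimes>\<^sub>M S) S (\<lambda>(x, \<eta>). case_nat x \<eta>) = S"
    unfolding S_def by (rule PiM_iter)
  interpret PS: prob_space S unfolding S_def by (rule prob_space_PiM) unfold_locales
  have mH: "(\<lambda>\<eta>. H (\<Sum>i<Suc j. of_bool (\<eta> i))) \<in> borel_measurable S"
    by (rule measurable_compose[OF s]) auto
  have "(\<integral>\<^sup>+\<eta>. H (\<Sum>i<Suc j. of_bool (\<eta> i)) \<partial>S)
      = (\<integral>\<^sup>+\<eta>. H (\<Sum>i<Suc j. of_bool (\<eta> i)) \<partial>distr (?b \<Otimes>\<^sub>M S) S (\<lambda>(x, \<eta>). case_nat x \<eta>))"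
    by (simp only: it)
  also have "\<dots> = (\<integral>\<^sup>+p. H (\<Sum>i<Suc j. of_bool ((case p of (x, \<eta>) \<Rightarrow> case_nat x \<eta>) i)) \<partial>(?b \<Otimes>\<^sub>M S))"
    by (rule nn_integral_distr[OF m]) (simp only: measurable_distr_eq1 mH)
  also have "\<dots> = (\<integral>\<^sup>+x. \<integral>\<^sup>+\<eta>. H (\<Sum>i<Suc j. of_bool (case_nat x \<eta> i)) \<partial>S \<partial>?b)"
    using PS.nn_integral_fst[OF measurable_compose[OF m mH], symmetric] by simp
  also have "\<dots> = (\<integral>\<^sup>+x. \<integral>\<^sup>+\<eta>. H (of_bool x + (\<Sum>i<j. of_bool (\<eta> i))) \<partial>S \<partial>?b)"
    by (simp add: sum.lessThan_Suc_shift del: sum.lessThan_Suc)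
  also have "\<dots> = ennreal \<alpha> * (\<integral>\<^sup>+\<eta>. H (Suc (\<Sum>i<j. of_bool (\<eta> i))) \<partial>S)
       + ennreal (1 - \<alpha>) * (\<integral>\<^sup>+\<eta>. H (\<Sum>i<j. of_bool (\<eta> i)) \<partial>S)"
    using assms(1) by (simp add: mult.commute)
  finally show ?thesis .
qed

lemma nn_integral_thinned_truncated:
  assumes "\<alpha> \<in> {0..1}" "0 \<le> lam" "\<And>n. 0 \<le> h n" "\<And>n. K \<le> n \<Longrightarrow> h n = 0"
  shows "(\<integral>\<^sup>+\<eta>. \<integral>\<^sup>+z. ennreal (h ((\<Sum>i<j. of_bool (\<eta> i)) + z)) \<partial>measure_pmf (Po ((1 - \<alpha>) * lam))
       \<partial>(\<Pi>\<^sub>M i\<in>(UNIV :: nat set). measure_pmf (bernoulli_pmf \<alpha>))) = ennreal (thin_expect K lam \<alpha> j h)"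
  using assms(3,4)
proof (induction j arbitrary: h)
  case 0
  interpret prob_space "\<Pi>\<^sub>M i\<in>(UNIV :: nat set). measure_pmf (bernoulli_pmf \<alpha>)"
    by (rule prob_space_PiM) unfold_locales
  have "(\<integral>\<^sup>+z. ennreal (h z) \<partial>measure_pmf (Po ((1 - \<alpha>) * lam))) = ennreal (poisson_sum K ((1 - \<alpha>) * lam) h)"
    using assms(1,2) 0 by (intro nn_integral_Po_truncated) auto
  then show ?case by (simp add: emeasure_space_1)
next
  case (Suc j)
  let ?S = "\<Pi>\<^sub>M i\<in>(UNIV :: nat set). measure_pmf (bernoulli_pmf \<alpha>)"
  let ?P = "measure_pmf (Po ((1 - \<alpha>) * lam))"
  have 1: "(\<integral>\<^sup>+\<eta>. \<integral>\<^sup>+z. ennreal (h (Suc (\<Sum>i<j. of_bool (\<eta> i)) + z)) \<partial>?P \<partial>?S)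
      = ennreal (thin_expect K lam \<alpha> j (\<lambda>n. h (Suc n)))"
    using Suc.IH[of "\<lambda>n. h (Suc n)"] Suc.prems by simp
  have 2: "(\<integral>\<^sup>+\<eta>. \<integral>\<^sup>+z. ennreal (h ((\<Sum>i<j. of_bool (\<eta> i)) + z)) \<partial>?P \<partial>?S)
      = ennreal (thin_expect K lam \<alpha> j h)"
    by (rule Suc.IH) (use Suc.prems in auto)
  show ?case
    unfolding nn_integral_bernoulli_sum_Suc[OF assms(1),
          where H="\<lambda>n. \<integral>\<^sup>+z. ennreal (h (n + z)) \<partial>?P"] 1 2
    using assms(1,2) Suc.prems
    by (simp add: thin_expect_nonneg flip: ennreal_mult ennreal_plus)
qed

text \<open>
  The offset \<open>c\<close> is there for the induction: splitting off a successful Bernoulli variable raises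
  it by one.
\<close>

lemma nn_integral_thinned_mean:
  assumes "\<alpha> \<in> {0..1}" "0 \<le> lam"
  shows "(\<integral>\<^sup>+\<eta>. \<integral>\<^sup>+z. ennreal (real ((\<Sum>i<j. of_bool (\<eta> i)) + z + c)) \<partial>measure_pmf (Po ((1 - \<alpha>) * lam))
       \<partial>(\<Pi>\<^sub>M i\<in>(UNIV :: nat set). measure_pmf (bernoulli_pmf \<alpha>)))
     = ennreal (\<alpha> * real j + (1 - \<alpha>) * lam + real c)"
proof (induction j arbitrary: c)
  case 0
  interpret prob_space "\<Pi>\<^sub>M i\<in>(UNIV :: nat set). measure_pmf (bernoulli_pmf \<alpha>)"
    by (rule prob_space_PiM) unfold_locales
  have "(\<integral>\<^sup>+z. ennreal (real (z + c)) \<partial>measure_pmf (Po ((1 - \<alpha>) * lam))) = ennreal ((1 - \<alpha>) * lam + real c)"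
    using assms by (intro nn_integral_Po_shift) auto
  then show ?case by (simp add: emeasure_space_1)
next
  case (Suc j)
  let ?S = "\<Pi>\<^sub>M i\<in>(UNIV :: nat set). measure_pmf (bernoulli_pmf \<alpha>)"
  let ?P = "measure_pmf (Po ((1 - \<alpha>) * lam))"
  have nn: "0 \<le> \<alpha> * real j + (1 - \<alpha>) * lam" using assms by auto
  have "\<alpha> * (\<alpha> * real j + (1 - \<alpha>) * lam + real (Suc c)) + (1 - \<alpha>) * (\<alpha> * real j + (1 - \<alpha>) * lam + real c)
      = \<alpha> * real (Suc j) + (1 - \<alpha>) * lam + real c"
    by (simp add: algebra_simps)
  then have eq: "ennreal \<alpha> * ennreal (\<alpha> * real j + (1 - \<alpha>) * lam + real (Suc c))
      + ennreal (1 - \<alpha>) * ennreal (\<alpha> * real j + (1 - \<alpha>) * lam + real c)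
      = ennreal (\<alpha> * real (Suc j) + (1 - \<alpha>) * lam + real c)"
    using assms nn by (simp add: mult_nonneg_nonneg add_nonneg_nonneg del: of_nat_Suc flip: ennreal_mult ennreal_plus)
  have 1: "(\<integral>\<^sup>+\<eta>. \<integral>\<^sup>+z. ennreal (real (Suc (\<Sum>i<j. of_bool (\<eta> i)) + z + c)) \<partial>?P \<partial>?S)
      = ennreal (\<alpha> * real j + (1 - \<alpha>) * lam + real (Suc c))"
    unfolding Suc.IH[symmetric] by simp
  show ?case
    unfolding nn_integral_bernoulli_sum_Suc[OF assms(1),
          where H="\<lambda>n. \<integral>\<^sup>+z. ennreal (real (n + z + c)) \<partial>?P"] 1 Suc.IH by (rule eq)
qed

lemma nn_integral_W_alpha:
  fixes \<phi> :: "nat \<Rightarrow> ennreal"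
  assumes W: "nat_rv M W" and X: "nat_rv_with_law A X (W_alpha_law M W lam \<alpha>)"
  shows "(\<integral>\<^sup>+w. \<phi> (X w) \<partial>A) = (\<integral>\<^sup>+w. \<integral>\<^sup>+\<eta>. \<integral>\<^sup>+z. \<phi> ((\<Sum>i<W w. of_bool (\<eta> i)) + z)
       \<partial>measure_pmf (Po ((1 - \<alpha>) * lam))
       \<partial>(\<Pi>\<^sub>M i\<in>(UNIV :: nat set). measure_pmf (bernoulli_pmf \<alpha>)) \<partial>M)"
proof -
  let ?S = "\<Pi>\<^sub>M i\<in>(UNIV :: nat set). measure_pmf (bernoulli_pmf \<alpha>)"
  let ?P = "measure_pmf (Po ((1 - \<alpha>) * lam))"
  have mX: "X \<in> A \<rightarrow>\<^sub>M count_space UNIV"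
    and law: "distr A (count_space UNIV) X = W_alpha_law M W lam \<alpha>"
    using X by (simp_all add: nat_rv_with_law_def nat_rv_def)
  have mW: "W \<in> M \<rightarrow>\<^sub>M count_space UNIV" using W by (simp add: nat_rv_def)
  interpret S: prob_space ?S by (rule prob_space_PiM) unfold_locales
  interpret SP: pair_prob_space ?S ?P ..
  note m = W_alpha_measurable[OF mW, of lam \<alpha>]
  have m': "(\<lambda>p. \<phi> (case p of (w, \<eta>, z) \<Rightarrow> (\<Sum>i<W w. of_bool (\<eta> i)) + z)) \<in> borel_measurable (M \<Otimes>\<^sub>M (?S \<Otimes>\<^sub>M ?P))"
    using measurable_compose[OF m, of \<phi> borel] unfolding W_alpha_space_def by simp
  have "(\<integral>\<^sup>+w. \<phi> (X w) \<partial>A) = (\<integral>\<^sup>+n. \<phi> n \<partial>distr A (count_space UNIV) X)"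
    by (rule nn_integral_distr[OF mX, symmetric]) simp
  also have "\<dots> = (\<integral>\<^sup>+p. \<phi> (case p of (w, \<eta>, z) \<Rightarrow> (\<Sum>i<W w. of_bool (\<eta> i)) + z) \<partial>W_alpha_space M lam \<alpha>)"
    unfolding law W_alpha_law_def by (rule nn_integral_distr[OF m]) simp
  also have "\<dots> = (\<integral>\<^sup>+w. \<integral>\<^sup>+q. \<phi> (case (w, q) of (w, \<eta>, z) \<Rightarrow> (\<Sum>i<W w. of_bool (\<eta> i)) + z) \<partial>(?S \<Otimes>\<^sub>M ?P) \<partial>M)"
    unfolding W_alpha_space_def by (rule SP.nn_integral_fst[OF m', symmetric])
  also have "\<dots> = (\<integral>\<^sup>+w. \<integral>\<^sup>+\<eta>. \<integral>\<^sup>+z. \<phi> ((\<Sum>i<W w. of_bool (\<eta> i)) + z) \<partial>?P \<partial>?S \<partial>M)"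
  proof (rule nn_integral_cong)
    fix w assume w: "w \<in> space M"
    have "(\<lambda>q. \<phi> (case (w, q) of (w, \<eta>, z) \<Rightarrow> (\<Sum>i<W w. of_bool (\<eta> i)) + z)) \<in> borel_measurable (?S \<Otimes>\<^sub>M ?P)"
      by (rule measurable_compose[OF measurable_Pair1'[OF w] m'])
    from measure_pmf.nn_integral_fst[OF this, symmetric]
    show "(\<integral>\<^sup>+q. \<phi> (case (w, q) of (w, \<eta>, z) \<Rightarrow> (\<Sum>i<W w. of_bool (\<eta> i)) + z) \<partial>(?S \<Otimes>\<^sub>M ?P))
        = (\<integral>\<^sup>+\<eta>. \<integral>\<^sup>+z. \<phi> ((\<Sum>i<W w. of_bool (\<eta> i)) + z) \<partial>?P \<partial>?S)"
      by simp
  qed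
  finally show ?thesis .
qed

text \<open>
  Thinning lowers the mean to \<open>\<alpha> * lam\<close> and the Poisson variable restores it, so the mean is
  constant along the family.
\<close>

lemma W_alpha_mean:
  assumes W: "nat_rv M W" "integrable M (\<lambda>w. real (W w))" "(\<integral>w. real (W w) \<partial>M) = lam"
    and \<alpha>: "\<alpha> \<in> {0..1}" and X: "nat_rv_with_law A X (W_alpha_law M W lam \<alpha>)"
  shows "has_bochner_integral A (\<lambda>w. real (X w)) lam"
proof -
  interpret prob_space M using W by (simp add: nat_rv_def)
  have [measurable]: "X \<in> A \<rightarrow>\<^sub>M count_space UNIV"
    using X by (simp_all add: nat_rv_with_law_def nat_rv_def)
  have lam: "0 \<le> lam" unfolding W(3)[symmetric] by simp
  have "(\<integral>\<^sup>+w. ennreal (real (X w)) \<partial>A) = (\<integral>\<^sup>+w. ennreal (\<alpha> * real (W w) + (1 - \<alpha>) * lam) \<partial>M)"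
    unfolding nn_integral_W_alpha[OF W(1) X, where \<phi>="\<lambda>n. ennreal (real n)"]
    using nn_integral_thinned_mean[OF \<alpha> lam, where c=0] by simp
  also have "\<dots> = ennreal (\<integral>w. \<alpha> * real (W w) + (1 - \<alpha>) * lam \<partial>M)"
    using W(2) \<alpha> lam by (intro nn_integral_eq_integral) auto
  also have "(\<integral>w. \<alpha> * real (W w) + (1 - \<alpha>) * lam \<partial>M) = lam"
    using W(2,3) by (simp add: prob_space algebra_simps)
  finally show ?thesis
    using lam by (intro has_bochner_integral_nn_integral) auto
qed

lemma W_alpha_truncated:
  assumes W: "nat_rv M W" and lam: "0 \<le> lam" and \<alpha>: "\<alpha> \<in> {0..1}"
    and X: "nat_rv_with_law A X (W_alpha_law M W lam \<alpha>)"
  shows "(\<integral>w. real (k - X w) \<partial>A) = (\<integral>w. thin_expect k lam \<alpha> (W w) (\<lambda>n. real (k - n)) \<partial>M)"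
proof -
  have [measurable]: "X \<in> A \<rightarrow>\<^sub>M count_space UNIV" "W \<in> M \<rightarrow>\<^sub>M count_space UNIV"
    using X W by (simp_all add: nat_rv_with_law_def nat_rv_def)
  have "(\<integral>\<^sup>+w. ennreal (real (k - X w)) \<partial>A)
      = (\<integral>\<^sup>+w. ennreal (thin_expect k lam \<alpha> (W w) (\<lambda>n. real (k - n))) \<partial>M)"
    unfolding nn_integral_W_alpha[OF W X, where \<phi>="\<lambda>n. ennreal (real (k - n))"]
    by (intro nn_integral_cong nn_integral_thinned_truncated[OF \<alpha> lam]) auto
  then show ?thesis
    using \<alpha> lam by (simp add: integral_eq_nn_integral thin_expect_nonneg)
qed

section \<open>Monotonicity in the thinning parameter\<close>

text \<open>
  The sum is \<open>lam * (E u (W) - E u (W\<^sup>* - 1))\<close>: size biasing absorbs the factor \<open>j\<close>.  As \<open>u\<close> is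
  antimonotone, the stochastic order applied to \<open>x \<mapsto> - u (x - 1)\<close> determines the sign.
\<close>

lemma size_bias_le:
  fixes u :: "nat \<Rightarrow> real"
  assumes W: "nat_rv M W" and lam: "0 < lam"
    and V: "size_biased N V M W lam"
    and st: "st_le N (\<lambda>w. real (V w)) M (\<lambda>w. real (W w + 1))"
    and u: "antimono u" "\<And>j. 0 \<le> u j" "\<And>j. u j \<le> 1"
  shows "(\<Sum>j. measure M {w \<in> space M. W w = j} * (lam * u j - real j * u (j - 1))) \<le> 0"
proof -
  let ?p = "\<lambda>j. measure M {w \<in> space M. W w = j}"
  have N: "nat_rv N V" and Vp: "\<And>j. measure N {w \<in> space N. V w = j} = real j * ?p j / lam"
    using V by (auto simp: size_biased_def)
  have ub: "\<bar>u j\<bar> \<le> 1" for j using u(2,3)[of j] by simp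
  have iW: "integrable M (\<lambda>w. u (W w))" by (rule nat_rv_integrable_bounded[OF W ub])
  have iV: "integrable N (\<lambda>w. u (V w - 1))"
    by (rule nat_rv_integrable_bounded[OF N, where \<phi>="\<lambda>n. u (n - 1)"]) (rule ub)
  have "(\<lambda>j. lam * (?p j * u j) - lam * (real j * ?p j / lam * u (j - 1))) sums
      (lam * (\<integral>w. u (W w) \<partial>M) - lam * (\<integral>w. u (V w - 1) \<partial>N))"
    using nat_rv_sums[OF W iW] nat_rv_sums[OF N, where \<phi>="\<lambda>n. u (n - 1)", OF iV]
    unfolding Vp by (intro sums_diff sums_mult)
  moreover have "lam * (?p j * u j) - lam * (real j * ?p j / lam * u (j - 1))
      = ?p j * (lam * u j - real j * u (j - 1))" for j
    using lam by (simp add: algebra_simps)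
  ultimately have "(\<Sum>j. ?p j * (lam * u j - real j * u (j - 1)))
      = lam * (\<integral>w. u (W w) \<partial>M) - lam * (\<integral>w. u (V w - 1) \<partial>N)"
    by (simp add: sums_iff)
  moreover have "(\<integral>w. u (W w) \<partial>M) \<le> (\<integral>w. u (V w - 1) \<partial>N)"
  proof -
    \<comment> \<open>The order is tested by monotone functions on the reals, hence the extension by the floor.  At 0
      the truncated subtraction gives the argument 0, which keeps the function monotone.\<close>
    define f where "f x = - u (nat \<lfloor>x\<rfloor> - 1)" for x :: real
    have "mono f"
      unfolding f_def by (intro monoI) (auto intro!: antimonoD[OF u(1)] diff_le_mono nat_mono floor_mono)
    moreover have fn: "f (real n) = - u (n - 1)" for n by (simp add: f_def)
    moreover have "integrable N (\<lambda>w. f (real (V w)))" "integrable M (\<lambda>w. f (real (W w + 1)))"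
      unfolding fn using iV iW by simp_all
    ultimately have "(\<integral>w. f (real (V w)) \<partial>N) \<le> (\<integral>w. f (real (W w + 1)) \<partial>M)"
      using st unfolding st_le_def by blast
    then show ?thesis unfolding fn by simp
  qed
  ultimately show ?thesis using lam by simp
qed

lemma thin_expect_put_bounds:
  assumes "\<alpha> \<in> {0..1}" "0 \<le> lam"
  shows "\<bar>thin_expect k lam \<alpha> j (\<lambda>n. real (k - n))\<bar> \<le> real k"
proof -
  have "thin_expect k lam \<alpha> j (\<lambda>n. real (k - n)) \<le> thin_expect k lam \<alpha> j (\<lambda>n. real k)"
    using assms by (intro thin_expect_mono) auto
  also have "\<dots> = real k * thin_expect k lam \<alpha> j (\<lambda>n. 1)"
    by (induction j) (simp_all add: poisson_sum_def sum_distrib_left algebra_simps)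
  also have "\<dots> \<le> real k * 1"
    using assms by (intro mult_left_mono thin_expect_one_le) auto
  finally show ?thesis using thin_expect_nonneg[OF assms, of "\<lambda>n. real (k - n)" k j] by simp
qed

text \<open>
  The main inequality.  The derivatives are dominated by \<open>P (W = j) * (lam + j)\<close>, which is summable
  as \<open>W\<close> has finite mean, so the series over the values of \<open>W\<close> may be differentiated
  termwise on the whole of the unit interval; the sign comes from \<open>size_bias_le\<close>.
\<close>

lemma put_expectation_antimono:
  assumes W: "nat_rv M W" "integrable M (\<lambda>w. real (W w))" and lam: "0 < lam"
    and V: "size_biased N V M W lam"
    and st: "st_le N (\<lambda>w. real (V w)) M (\<lambda>w. real (W w + 1))"
    and ab: "0 \<le> \<beta>" "\<beta> \<le> \<alpha>" "\<alpha> \<le> 1"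
  shows "(\<integral>w. thin_expect k lam \<alpha> (W w) (\<lambda>n. real (k - n)) \<partial>M)
       \<le> (\<integral>w. thin_expect k lam \<beta> (W w) (\<lambda>n. real (k - n)) \<partial>M)"
proof -
  let ?p = "\<lambda>j. measure M {w \<in> space M. W w = j}"
  let ?h = "\<lambda>n. real (k - n)"
  let ?g = "\<lambda>\<alpha> j. thin_expect k lam \<alpha> j ?h"
  \<comment> \<open>The indicator is the negated forward difference of the put function, so \<open>u \<alpha> j\<close> is the
    probability that the queue started from \<open>j\<close> customers has fewer than \<open>k\<close>, and \<open>D j\<close> is the
    derivative of the \<open>j\<close>-th term.\<close>
  define i where "i n = (if n < k then 1 else 0 :: real)" for n :: nat
  define u where "u \<alpha> j = thin_expect k lam \<alpha> j i" for \<alpha> j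
  define D where "D j \<alpha> = ?p j * (lam * u \<alpha> j - real j * u \<alpha> (j - 1))" for \<alpha> j
  have u: "antimono (u x)" "\<And>j. 0 \<le> u x j" "\<And>j. u x j \<le> 1" if "x \<in> {0..1}" for x
  proof -
    show "antimono (u x)" unfolding u_def using that lam
      by (intro thin_expect_antimono) (auto simp: i_def antimono_def)
    show "0 \<le> u x j" for j unfolding u_def using that lam
      by (intro thin_expect_nonneg) (auto simp: i_def)
    show "u x j \<le> 1" for j
    proof -
      have "u x j \<le> thin_expect k lam x j (\<lambda>_. 1)"
        unfolding u_def using that lam by (intro thin_expect_mono) (auto simp: i_def)
      then show ?thesis using thin_expect_one_le[OF that, of lam k j] lam by simp
    qed
  qed
  have h': "(\<lambda>n. real (k - Suc n) - real (k - n)) = (\<lambda>n. 0 - i n)"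
    by (auto simp: i_def fun_eq_iff)
  have deriv: "((\<lambda>x. ?p j * ?g x j) has_real_derivative D j x) (at x within T)" for j x T
  proof -
    have "thin_expect k lam x j (\<lambda>n. 0 - i n) = - u x j" for j
      unfolding thin_expect_diff thin_expect_zero u_def by simp
    then have "((\<lambda>x. ?g x j) has_real_derivative (lam * u x j - real j * u x (j - 1))) (at x)"
      using DERIV_thin_expect[of k ?h lam j x] unfolding h' by simp
    then show ?thesis unfolding D_def
      by (intro DERIV_cmult) (rule has_field_derivative_at_within)
  qed
  have one: "(\<lambda>j. ?p j * 1) sums (\<integral>w. 1 \<partial>M)"
    using nat_rv_sums[OF W(1) nat_rv_integrable_bounded[OF W(1), where \<phi>="\<lambda>_. 1" and B=1]] by simp
  have sm: "summable (\<lambda>j. ?p j * (lam + real j))"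
  proof -
    have "summable (\<lambda>j. lam * (?p j * 1) + ?p j * real j)"
      using one nat_rv_sums[OF W] by (intro summable_add summable_mult) (auto simp: sums_iff)
    then show ?thesis by (simp add: algebra_simps)
  qed
  have bound: "norm (D j x) \<le> ?p j * (lam + real j)" if "x \<in> {0..1}" for x j
  proof -
    have "\<bar>lam * u x j - real j * u x (j - 1)\<bar> \<le> \<bar>lam * u x j\<bar> + \<bar>real j * u x (j - 1)\<bar>"
      by (rule abs_triangle_ineq4)
    also have "\<dots> \<le> lam * 1 + real j * 1"
      unfolding abs_mult using u(2,3)[OF that] lam by (intro add_mono mult_mono) auto
    finally have "\<bar>lam * u x j - real j * u x (j - 1)\<bar> \<le> lam + real j" by simp
    then show ?thesis
      unfolding D_def real_norm_def abs_mult by (intro mult_mono) auto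
  qed
  have ul: "uniform_limit {0..1} (\<lambda>n x. \<Sum>j<n. D j x) (\<lambda>x. \<Sum>j. D j x) sequentially"
    by (rule Weierstrass_m_test[OF bound sm])
  have gs: "(\<lambda>j. ?p j * ?g x j) sums (\<integral>w. ?g x (W w) \<partial>M)" if "x \<in> {0..1}" for x
    by (rule nat_rv_sums[OF W(1) nat_rv_integrable_bounded[OF W(1), where \<phi>="?g x"]])
       (rule thin_expect_put_bounds[OF that less_imp_le[OF lam]])
  have "\<exists>F. \<forall>x\<in>{0..1}. (\<lambda>j. ?p j * ?g x j) sums F x
      \<and> (F has_field_derivative (\<Sum>j. D j x)) (at x within {0..1})"
    by (rule has_field_derivative_series[OF _ deriv ul, of 0]) (use gs[of 0] in \<open>auto simp: sums_iff\<close>)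
  then obtain F where F: "\<And>x. x \<in> {0..1} \<Longrightarrow> (\<lambda>j. ?p j * ?g x j) sums F x"
    "\<And>x. x \<in> {0..1} \<Longrightarrow> (F has_real_derivative (\<Sum>j. D j x)) (at x within {0..1})"
    by blast
  have Feq: "F x = (\<integral>w. ?g x (W w) \<partial>M)" if "x \<in> {0..1}" for x
    using F(1)[OF that] gs[OF that] by (rule sums_unique2)
  have neg: "(\<Sum>j. D j x) \<le> 0" if "x \<in> {0..1}" for x
    unfolding D_def by (rule size_bias_le[OF W(1) lam V st u[OF that]])
  have "F \<alpha> \<le> F \<beta>"
  proof (rule DERIV_nonpos_imp_decreasing_open[OF ab(2)])
    fix x assume x: "\<beta> < x" "x < \<alpha>"
    then have "at x within {0..1} = at x" using ab by (intro at_within_interior) auto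
    then show "\<exists>y. DERIV F x :> y \<and> y \<le> 0"
      using F(2)[of x] neg[of x] x ab by auto
  next
    have "continuous_on {0..1} F" using F(2) by (rule DERIV_continuous_on)
    then show "continuous_on {\<beta>..\<alpha>} F" by (rule continuous_on_subset) (use ab in auto)
  qed
  then show ?thesis using ab by (simp add: Feq)
qed

lemma poisson_sum_at_0: "poisson_sum k 0 h = (if k = 0 then 0 else h 0)"
proof (cases k)
  case (Suc m)
  show ?thesis unfolding Suc poisson_sum_def sum.lessThan_Suc_shift by simp
qed (simp add: poisson_sum_def)

lemma thin_expect_at_1: "thin_expect k lam 1 j h = (if k = 0 then 0 else h j)"
  by (induction j arbitrary: h) (simp_all add: poisson_sum_at_0)

theorem theorem2p2:
  fixes M :: "'a measure" and W :: "'a \<Rightarrow> nat"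
    and N :: "'b measure" and Wstar :: "'b \<Rightarrow> nat"
    and lam :: real
  assumes "nat_rv M W"
    and "integrable M (\<lambda>w. real (W w))"
    and "(\<integral>w. real (W w) \<partial>M) = lam"
    and "lam > 0"
    and "size_biased N Wstar M W lam"
    and "st_le N (\<lambda>w. real (Wstar w)) M (\<lambda>w. real (W w + 1))"
  shows "(\<forall>\<alpha> \<in> {0..1}. \<forall>\<beta> \<in> {0..1}. \<alpha> \<ge> \<beta> \<longrightarrow>
            (\<forall>(A :: 'c measure) X (B :: 'd measure) Y.
               nat_rv_with_law A X (W_alpha_law M W lam \<alpha>) \<longrightarrow>
               nat_rv_with_law B Y (W_alpha_law M W lam \<beta>) \<longrightarrow>
               cx_le A (\<lambda>w. real (X w)) B (\<lambda>w. real (Y w))))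
       \<and> (\<forall>(C :: 'e measure) Z.
            nat_rv_with_law C Z (measure_pmf (Po lam)) \<longrightarrow>
            cx_le M (\<lambda>w. real (W w)) C (\<lambda>w. real (Z w)))"
proof (intro conjI ballI allI impI)
  note lam0 = less_imp_le[OF assms(4)]
  fix \<alpha> \<beta> :: real and A :: "'c measure" and X and B :: "'d measure" and Y
  assume ab: "\<alpha> \<in> {0..1}" "\<beta> \<in> {0..1}" "\<beta> \<le> \<alpha>"
    and X: "nat_rv_with_law A X (W_alpha_law M W lam \<alpha>)"
    and Y: "nat_rv_with_law B Y (W_alpha_law M W lam \<beta>)"
  show "cx_le A (\<lambda>w. real (X w)) B (\<lambda>w. real (Y w))"
  proof (rule cx_le_of_put_le)
    show "nat_rv A X" "nat_rv B Y" using X Y by (auto simp: nat_rv_with_law_def)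
    show "integrable A (\<lambda>w. real (X w))" "integrable B (\<lambda>w. real (Y w))"
      "(\<integral>w. real (X w) \<partial>A) = (\<integral>w. real (Y w) \<partial>B)"
      using W_alpha_mean[OF assms(1-3) ab(1) X] W_alpha_mean[OF assms(1-3) ab(2) Y]
      by (auto simp: has_bochner_integral_iff)
    show "(\<integral>w. real (k - X w) \<partial>A) \<le> (\<integral>w. real (k - Y w) \<partial>B)" for k
      unfolding W_alpha_truncated[OF assms(1) lam0 ab(1) X] W_alpha_truncated[OF assms(1) lam0 ab(2) Y]
      by (rule put_expectation_antimono[OF assms(1,2,4-6)]) (use ab in auto)
  qed
next
  fix C :: "'e measure" and Z
  assume Z: "nat_rv_with_law C Z (measure_pmf (Po lam))"
  have rv: "nat_rv C Z" and law: "distr C (count_space UNIV) Z = measure_pmf (Po lam)"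
    and mZ [measurable]: "Z \<in> C \<rightarrow>\<^sub>M count_space UNIV"
    using Z by (auto simp: nat_rv_with_law_def nat_rv_def)
  have nnZ: "(\<integral>\<^sup>+w. \<phi> (Z w) \<partial>C) = (\<integral>\<^sup>+n. \<phi> n \<partial>measure_pmf (Po lam))" for \<phi>
    unfolding law[symmetric] by (rule nn_integral_distr[OF mZ, symmetric]) simp
  interpret M: prob_space M using assms(1) by (simp add: nat_rv_def)
  have meanZ: "has_bochner_integral C (\<lambda>w. real (Z w)) lam"
    using nn_integral_Po_shift[of lam 0] assms(4)
    by (intro has_bochner_integral_nn_integral)
       (auto simp: nnZ[where \<phi>="\<lambda>n. ennreal (real n)"])
  show "cx_le M (\<lambda>w. real (W w)) C (\<lambda>w. real (Z w))"
  proof (rule cx_le_of_put_le)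
    show "nat_rv M W" "nat_rv C Z" "integrable M (\<lambda>w. real (W w))" by fact+
    show "integrable C (\<lambda>w. real (Z w))" "(\<integral>w. real (W w) \<partial>M) = (\<integral>w. real (Z w) \<partial>C)"
      using meanZ assms(3) by (auto simp: has_bochner_integral_iff)
    show "(\<integral>w. real (k - W w) \<partial>M) \<le> (\<integral>w. real (k - Z w) \<partial>C)" for k
    proof -
      let ?h = "\<lambda>n. real (k - n)"
      have 0: "thin_expect k lam 0 j ?h = poisson_sum k lam ?h" for j
        by (induction j) auto
      have 1: "thin_expect k lam 1 j ?h = ?h j" for j
        by (simp add: thin_expect_at_1)
      have pos: "0 \<le> poisson_sum k lam ?h"
        unfolding poisson_sum_def using assms(4) by (intro sum_nonneg) auto
      have "(\<integral>\<^sup>+w. ennreal (?h (Z w)) \<partial>C) = ennreal (poisson_sum k lam ?h)"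
        unfolding nnZ[where \<phi>="\<lambda>n. ennreal (?h n)"] using assms(4)
        by (intro nn_integral_Po_truncated) auto
      then have "has_bochner_integral C (\<lambda>w. ?h (Z w)) (poisson_sum k lam ?h)"
        using pos by (intro has_bochner_integral_nn_integral) auto
      moreover have "(\<integral>w. ?h (W w) \<partial>M) \<le> (\<integral>w. poisson_sum k lam ?h \<partial>M)"
        using put_expectation_antimono[OF assms(1,2,4-6), of 0 1 k] unfolding 0 1 by simp
      ultimately show ?thesis
        by (simp add: M.prob_space has_bochner_integral_iff)
    qed
  qed
qed

end
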